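(* Let $F$ be a probability distribution on the non-negative integers, and run the Stepwise Pairing algorithm with Random Directions (SPRD) on $\mathbb{Z}$ with degree distribution $F$ and right-probability $p=1/2$. Let $N\in\{0,1,2,\ldots\}\cup\{\infty\}$ be the maximum of the lengths of the edges formed by the arrows at the origin (with an arrow that is never connected counted as length $\infty$). Then $P_{1/2}(N<\infty)=1$.
   Context: SPRD algorithm with parameters $F$ and $p\in[0,1]$: to each vertex $i\in\mathbb{Z}$ attach $D_i$ stubs, where $(D_i)_{i\in\mathbb{Z}}$ are i.i.d. with distribution $F$. Independently of everything else, each stub is turned into a right-arrow with probability $p$ and into a left-arrow with probability $1-p$. $R_i$ and $L_i$ denote the numbers of right- and left-arrows at $i$ (so $R_i+L_i=D_i$), and the arrows at $i$ are labelled $r_{i,1},\ldots,r_{i,R_i}$ and $l_{i,1},\ldots,l_{i,L_i}$. $P_p$ is the corresponding probability measure. Stepwise pairing: for $n=1,2,3,\ldots$ in order, step $n$ considers all pairs of vertices $i,i+n$ at distance $n$; if $a$ right-arrows at $i$ and $b$ left-arrows at $i+n$ are still unconnected after steps $1,\ldots,n-1$, then $\min\{a,b\}$ edges are created between $i$ and $i+n$, each joining one unconnected right-arrow at $i$ with one unconnected left-arrow at $i+n$, the arrows at each vertex (of each direction) being used in increasing order of their labels. The length of an edge is the distance between its endpoints. For $1\le j\le R_0$, $N_j^{(r)}$ is the length of the edge formed by $r_{0,j}$, with $N_j^{(r)}=\infty$ if $r_{0,j}$ is never connected; for $1\le j\le L_0$, $N_j^{(l)}$ is defined analogously using $l_{0,j}$.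 Put $N^{(r)}=\max_{1\le j\le R_0}N_j^{(r)}$, $N^{(l)}=\max_{1\le j\le L_0}N_j^{(l)}$ (a maximum over the empty set is $0$), and $N=\max\{N^{(r)},N^{(l)}\}$. *)

theory Defs
  imports "HOL-Probability.Probability"
begin

text \<open>
  Stub \<open>k < D i \<omega>\<close> at vertex \<open>i\<close> becomes a right-arrow iff the coin \<open>B i k \<omega>\<close> is \<open>True\<close>. A coin is
  provided for every \<open>k\<close>, so that the coins form a family independent of the degrees; those
  with \<open>k \<ge> D i \<omega>\<close> are never used. The last assumption is independence of the whole family of
  degrees from the whole family of coins, stated through the generated sigma-algebras because
  \<^const>\<open>prob_space.indep_var\<close> requires both random variables to have the same type.
\<close>

locale sprd = prob_space M
  for M :: "'a measure" and F :: "nat pmf" and p :: real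
    and D :: "int \<Rightarrow> 'a \<Rightarrow> nat" and B :: "int \<Rightarrow> nat \<Rightarrow> 'a \<Rightarrow> bool" +
  assumes p_range: "0 \<le> p" "p \<le> 1"
    and indep_degrees: "indep_vars (\<lambda>_. count_space UNIV) D UNIV"
    and distr_degrees: "\<And>i. distr M (count_space UNIV) (D i) = measure_pmf F"
    and indep_coins: "indep_vars (\<lambda>_. count_space UNIV) (\<lambda>(i, k). B i k) UNIV"
    and distr_coins: "\<And>i k. distr M (count_space UNIV) (B i k) = measure_pmf (bernoulli_pmf p)"
    and indep_degrees_coins:
      "indep_set (sets (vimage_algebra (space M) (\<lambda>\<omega> i. D i \<omega>) (Pi\<^sub>M UNIV (\<lambda>_. count_space UNIV))))
                 (sets (vimage_algebra (space M) (\<lambda>\<omega> (i, k). B i k \<omega>) (Pi\<^sub>M UNIV (\<lambda>_. count_space UNIV))))"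

text \<open>The assumptions are satisfiable:\<close>

lemma sprd_exists:
  assumes "0 \<le> p" "p \<le> 1"
  shows "\<exists>(M :: ((int \<Rightarrow> nat) \<times> (int \<times> nat \<Rightarrow> bool)) measure) D B. sprd M F p D B"
proof -
  let ?MD = "Pi\<^sub>M UNIV (\<lambda>_::int. measure_pmf F)"
  let ?MB = "Pi\<^sub>M UNIV (\<lambda>_::int \<times> nat. measure_pmf (bernoulli_pmf p))"
  let ?M = "?MD \<Otimes>\<^sub>M ?MB"
  interpret D: product_prob_space "\<lambda>_::int. measure_pmf F" UNIV ..
  interpret B: product_prob_space "\<lambda>_::int \<times> nat. measure_pmf (bernoulli_pmf p)" UNIV ..
  interpret P: pair_prob_space ?MD ?MB ..
  have sD: "sets ?MD = sets (Pi\<^sub>M UNIV (\<lambda>_::int. count_space UNIV))" by (rule sets_PiM_cong) auto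
  have sB: "sets ?MB = sets (Pi\<^sub>M UNIV (\<lambda>_::int \<times> nat. count_space UNIV))" by (rule sets_PiM_cong) auto
  have pD: "prob_space ?MD" and pB: "prob_space ?MB"
    by (auto intro!: prob_space_PiM measure_pmf.prob_space_axioms)
  have dfst: "distr ?M ?MD fst = ?MD" by (rule prob_space.distr_pair_fst[OF pB])
  have dsnd: "distr ?M ?MB snd = ?MB"
  proof -
    have "distr ?M ?MB snd = distr (?MB \<Otimes>\<^sub>M ?MD) ?MB fst"
      by (subst P.distr_pair_swap) (simp add: distr_distr comp_def case_prod_beta)
    then show ?thesis by (simp add: prob_space.distr_pair_fst[OF pD])
  qed
  have mD: "(\<lambda>\<omega>. fst \<omega> i) \<in> measurable ?M (count_space UNIV)" for i
    using measurable_compose[OF measurable_fst[of ?MD ?MB] measurable_component_singleton[of i UNIV "\<lambda>_. measure_pmf F"]]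
    by simp
  have mB: "(\<lambda>\<omega>. snd \<omega> i) \<in> measurable ?M (count_space UNIV)" for i
    using measurable_compose[OF measurable_snd[of ?MD ?MB] measurable_component_singleton[of i UNIV "\<lambda>_. measure_pmf (bernoulli_pmf p)"]]
    by simp
  have dD: "distr ?M (count_space UNIV) (\<lambda>\<omega>. fst \<omega> i) = measure_pmf F" for i
  proof -
    have "distr ?M (count_space UNIV) (\<lambda>\<omega>. fst \<omega> i) = distr (distr ?M ?MD fst) (measure_pmf F) (\<lambda>\<omega>. \<omega> i)"
      by (subst distr_distr) (auto simp: comp_def intro!: distr_cong)
    then show ?thesis by (simp add: dfst D.PiM_component)
  qed
  have dB: "distr ?M (count_space UNIV) (\<lambda>\<omega>. snd \<omega> i) = measure_pmf (bernoulli_pmf p)" for i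
  proof -
    have "distr ?M (count_space UNIV) (\<lambda>\<omega>. snd \<omega> i) = distr (distr ?M ?MB snd) (measure_pmf (bernoulli_pmf p)) (\<lambda>\<omega>. \<omega> i)"
      by (subst distr_distr) (auto simp: comp_def intro!: distr_cong)
    then show ?thesis by (simp add: dsnd B.PiM_component)
  qed
  have "sprd ?M F p (\<lambda>i \<omega>. fst \<omega> i) (\<lambda>i k \<omega>. snd \<omega> (i, k))"
  proof unfold_locales
    show "P.indep_vars (\<lambda>_. count_space UNIV) (\<lambda>i \<omega>. fst \<omega> i) UNIV"
    proof (subst P.indep_vars_iff_distr_eq_PiM)
      have "distr ?M (Pi\<^sub>M UNIV (\<lambda>_. count_space UNIV)) fst = distr ?M ?MD fst"
        by (rule distr_cong) (simp_all add: sD)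
      then show "distr ?M (Pi\<^sub>M UNIV (\<lambda>_. count_space UNIV)) (\<lambda>x. \<lambda>i\<in>UNIV. fst x i)
        = (\<Pi>\<^sub>M i\<in>UNIV. distr ?M (count_space UNIV) (\<lambda>\<omega>. fst \<omega> i))"
        by (simp add: dfst dD restrict_UNIV)
    qed (simp_all add: mD)
    have e: "(\<lambda>(i, k) \<omega>. snd \<omega> (i, k)) = (\<lambda>i (\<omega> :: (int \<Rightarrow> nat) \<times> (int \<times> nat \<Rightarrow> bool)). snd \<omega> i)" by auto
    show "P.indep_vars (\<lambda>_. count_space UNIV) (\<lambda>(i, k) \<omega>. snd \<omega> (i, k)) UNIV"
      unfolding e
    proof (subst P.indep_vars_iff_distr_eq_PiM)
      have "distr ?M (Pi\<^sub>M UNIV (\<lambda>_. count_space UNIV)) snd = distr ?M ?MB snd"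
        by (rule distr_cong) (simp_all add: sB)
      then show "distr ?M (Pi\<^sub>M UNIV (\<lambda>_. count_space UNIV)) (\<lambda>x. \<lambda>i\<in>UNIV. snd x i)
        = (\<Pi>\<^sub>M i\<in>UNIV. distr ?M (count_space UNIV) (\<lambda>\<omega>. snd \<omega> i))"
        by (simp add: dsnd dB restrict_UNIV)
    qed (simp_all add: mB)
    have c: "(\<lambda>\<omega> (i, k). snd \<omega> (i, k)) = (snd :: (int \<Rightarrow> nat) \<times> (int \<times> nat \<Rightarrow> bool) \<Rightarrow> _)" by auto
    show "P.indep_set (sets (vimage_algebra (space ?M) (\<lambda>\<omega> i. fst \<omega> i) (Pi\<^sub>M UNIV (\<lambda>_. count_space UNIV))))
      (sets (vimage_algebra (space ?M) (\<lambda>\<omega> (i, k). snd \<omega> (i, k)) (Pi\<^sub>M UNIV (\<lambda>_. count_space UNIV))))"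
    proof (rule P.indep_setI)
      have vD: "sets (vimage_algebra (space ?M) fst (Pi\<^sub>M UNIV (\<lambda>_. count_space UNIV)))
          = {fst -` A \<inter> space ?M |A. A \<in> sets ?MD}"
        by (subst sets_vimage_algebra2) (auto simp: sD space_PiM)
      have vB: "sets (vimage_algebra (space ?M) snd (Pi\<^sub>M UNIV (\<lambda>_. count_space UNIV)))
          = {snd -` A \<inter> space ?M |A. A \<in> sets ?MB}"
        by (subst sets_vimage_algebra2) (auto simp: sB space_PiM)
      show "sets (vimage_algebra (space ?M) (\<lambda>\<omega> i. fst \<omega> i) (Pi\<^sub>M UNIV (\<lambda>_. count_space UNIV))) \<subseteq> P.events"
        unfolding vD by (auto intro: measurable_sets[OF measurable_fst])
      show "sets (vimage_algebra (space ?M) (\<lambda>\<omega> (i, k). snd \<omega> (i, k)) (Pi\<^sub>M UNIV (\<lambda>_. count_space UNIV))) \<subseteq> P.events"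
        unfolding c vB by (auto intro: measurable_sets[OF measurable_snd])
      fix a b
      assume "a \<in> sets (vimage_algebra (space ?M) (\<lambda>\<omega> i. fst \<omega> i) (Pi\<^sub>M UNIV (\<lambda>_. count_space UNIV)))"
        and "b \<in> sets (vimage_algebra (space ?M) (\<lambda>\<omega> (i, k). snd \<omega> (i, k)) (Pi\<^sub>M UNIV (\<lambda>_. count_space UNIV)))"
      then obtain A C where A: "A \<in> sets ?MD" "a = fst -` A \<inter> space ?M"
        and C: "C \<in> sets ?MB" "b = snd -` C \<inter> space ?M"
        unfolding c vD vB by blast
      have "A \<subseteq> space ?MD" "C \<subseteq> space ?MB"
        using A(1) C(1) by (auto dest: sets.sets_into_space)
      then have "a = A \<times> space ?MB" "b = space ?MD \<times> C" "a \<inter> b = A \<times> C"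
        by (auto simp: A(2) C(2) space_pair_measure)
      moreover have "P.prob (X \<times> Y) = measure ?MD X * measure ?MB Y"
        if "X \<in> sets ?MD" "Y \<in> sets ?MB" for X Y
        using that sigma_finite_measure.emeasure_pair_measure_Times[OF prob_space_imp_sigma_finite[OF pB], of X ?MD Y]
        by (simp add: measure_def enn2real_mult)
      ultimately show "P.prob (a \<inter> b) = P.prob a * P.prob b"
        using A(1) C(1) prob_space.prob_space[OF pD] prob_space.prob_space[OF pB]
        by (simp add: sets.top)
    qed
  qed (use assms in \<open>auto simp: dD dB\<close>)
  then show ?thesis by blast
qed

definition num_right :: "(int \<Rightarrow> 'a \<Rightarrow> nat) \<Rightarrow> (int \<Rightarrow> nat \<Rightarrow> 'a \<Rightarrow> bool) \<Rightarrow> 'a \<Rightarrow> int \<Rightarrow> nat" where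
  "num_right D B \<omega> i = card {k. k < D i \<omega> \<and> B i k \<omega>}"

definition num_left :: "(int \<Rightarrow> 'a \<Rightarrow> nat) \<Rightarrow> (int \<Rightarrow> nat \<Rightarrow> 'a \<Rightarrow> bool) \<Rightarrow> 'a \<Rightarrow> int \<Rightarrow> nat" where
  "num_left D B \<omega> i = card {k. k < D i \<omega> \<and> \<not> B i k \<omega>}"

text \<open>
  The pairing is a deterministic function of the arrow counts \<open>R\<close> and \<open>L\<close>. The pair \<open>(i, j)\<close>
  stands for the right-arrow \<open>r\<^bsub>i,j\<^esub>\<close> in the first component of an edge and for the left-arrow
  \<open>l\<^bsub>i,j\<^esub>\<close> in the second one; labels start at 1.
\<close>

type_synonym edge = "(int \<times> nat) \<times> (int \<times> nat)"

definition free_right :: "(int \<Rightarrow> nat) \<Rightarrow> edge set \<Rightarrow> int \<Rightarrow> nat set" where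
  "free_right R E i = {j \<in> {1..R i}. (i, j) \<notin> Domain E}"

definition free_left :: "(int \<Rightarrow> nat) \<Rightarrow> edge set \<Rightarrow> int \<Rightarrow> nat set" where
  "free_left L E i = {j \<in> {1..L i}. (i, j) \<notin> Range E}"

text \<open>
  In each step, the free right-arrow with the \<open>m\<close>-th smallest label at \<open>i\<close> is joined to the
  free left-arrow with the \<open>m\<close>-th smallest label at \<open>i'\<close>, as long as both exist.
\<close>

definition new_edges :: "(int \<Rightarrow> nat) \<Rightarrow> (int \<Rightarrow> nat) \<Rightarrow> edge set \<Rightarrow> nat \<Rightarrow> edge set" where
  "new_edges R L E n =
     {((i, sorted_list_of_set (free_right R E i) ! m),
       (i', sorted_list_of_set (free_left L E i') ! m)) | i i' m.
        i' = i + int n \<and> m < min (card (free_right R E i)) (card (free_left L E i'))}"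

primrec edges_upto :: "(int \<Rightarrow> nat) \<Rightarrow> (int \<Rightarrow> nat) \<Rightarrow> nat \<Rightarrow> edge set" where
  "edges_upto R L 0 = {}"
| "edges_upto R L (Suc n) = edges_upto R L n \<union> new_edges R L (edges_upto R L n) (Suc n)"

definition sprd_edges :: "(int \<Rightarrow> nat) \<Rightarrow> (int \<Rightarrow> nat) \<Rightarrow> edge set" where
  "sprd_edges R L = (\<Union>n. edges_upto R L n)"

lemma set_sorted_nth: "m < card A \<Longrightarrow> sorted_list_of_set A ! m \<in> A" for A :: "nat set"
  by (metis card.infinite length_sorted_list_of_set not_less_zero nth_mem set_sorted_list_of_set)

lemma sorted_nth_inj: "m < card A \<Longrightarrow> m' < card A \<Longrightarrow>
   sorted_list_of_set A ! m = sorted_list_of_set A ! m' \<Longrightarrow> m = m'" for A :: "nat set"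
  by (simp add: nth_eq_iff_index_eq)

lemma new_edges_free:
  assumes "(x, y) \<in> new_edges R L E n"
  shows "x \<notin> Domain E \<and> y \<notin> Range E"
proof -
  obtain i i' m where x: "x = (i, sorted_list_of_set (free_right R E i) ! m)"
    and y: "y = (i', sorted_list_of_set (free_left L E i') ! m)"
    and m: "m < card (free_right R E i)" "m < card (free_left L E i')"
    using assms unfolding new_edges_def by auto
  show ?thesis
    using set_sorted_nth[OF m(1)] set_sorted_nth[OF m(2)]
    unfolding x y by (simp_all only: free_right_def free_left_def mem_Collect_eq not_False_eq_True simp_thms)
qed

lemma edges_upto_matching:
  "single_valued (edges_upto R L n) \<and> single_valued ((edges_upto R L n)\<inverse>)"
proof (induction n)
  case (Suc n)
  let ?E = "edges_upto R L n"
  have "single_valued (new_edges R L ?E (Suc n))" "single_valued ((new_edges R L ?E (Suc n))\<inverse>)"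
    unfolding new_edges_def by (auto simp: single_valued_def dest!: sorted_nth_inj[rotated 2])
  then show ?case using Suc new_edges_free[of _ _ R L ?E "Suc n"]
    unfolding single_valued_def edges_upto.simps by (blast)
qed (simp add: single_valued_def)

lemma edges_upto_mono: "m \<le> n \<Longrightarrow> edges_upto R L m \<subseteq> edges_upto R L n"
  by (induction n rule: dec_induct) auto

lemma sprd_edges_matching:
  "single_valued (sprd_edges R L) \<and> single_valued ((sprd_edges R L)\<inverse>)"
proof -
  have "\<exists>n. e \<in> edges_upto R L n \<and> e' \<in> edges_upto R L n"
    if "e \<in> sprd_edges R L" "e' \<in> sprd_edges R L" for e e'
  proof -
    obtain m n where "e \<in> edges_upto R L m" "e' \<in> edges_upto R L n"
      using \<open>e \<in> sprd_edges R L\<close> \<open>e' \<in> sprd_edges R L\<close> unfolding sprd_edges_def by blast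
    then show ?thesis
      using edges_upto_mono[of m "max m n" R L] edges_upto_mono[of n "max m n" R L] by auto
  qed
  then show ?thesis
    using edges_upto_matching[of R L] unfolding single_valued_def converse_iff by metis
qed

definition edge_length :: "edge \<Rightarrow> nat" where
  "edge_length e = nat \<bar>fst (snd e) - fst (fst e)\<bar>"

text \<open>
  Every arrow lies on at most one edge (\<open>sprd_edges_matching\<close>), so the infimum is the length of that edge if it exists;
  otherwise it is the infimum of the empty set, which is \<open>\<infinity>\<close> in \<open>enat\<close>.
\<close>

definition length_right :: "(int \<Rightarrow> nat) \<Rightarrow> (int \<Rightarrow> nat) \<Rightarrow> nat \<Rightarrow> enat" where
  "length_right R L j = (INF e\<in>{e \<in> sprd_edges R L. fst e = (0, j)}. enat (edge_length e))"

definition length_left :: "(int \<Rightarrow> nat) \<Rightarrow> (int \<Rightarrow> nat) \<Rightarrow> nat \<Rightarrow> enat" where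
  "length_left R L j = (INF e\<in>{e \<in> sprd_edges R L. snd e = (0, j)}. enat (edge_length e))"

text \<open>
  The suprema range over finite sets, so they are maxima; the supremum of the empty set is 0 in
  \<open>enat\<close>.
\<close>

definition max_length :: "(int \<Rightarrow> nat) \<Rightarrow> (int \<Rightarrow> nat) \<Rightarrow> enat" where
  "max_length R L = max (SUP j\<in>{1..R 0}. length_right R L j) (SUP j\<in>{1..L 0}. length_left R L j)"

definition sprd_N :: "(int \<Rightarrow> 'a \<Rightarrow> nat) \<Rightarrow> (int \<Rightarrow> nat \<Rightarrow> 'a \<Rightarrow> bool) \<Rightarrow> 'a \<Rightarrow> enat" where
  "sprd_N D B \<omega> = max_length (num_right D B \<omega>) (num_left D B \<omega>)"

end

theory Submission
  imports Defs
begin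

text \<open>
  Suppose that some right-arrow at \<open>0\<close> is never connected. Then for every \<open>k > 0\<close> all left-arrows at
  \<open>k\<close> are used up within \<open>k\<close> steps, hence by right-arrows in \<open>{0..<k}\<close>, so the walk with increments
  \<open>L k - R k\<close> stays bounded above by \<open>R 0\<close>. For \<open>p = 1/2\<close> and \<open>F \<noteq> \<delta>\<^sub>0\<close> these increments are independent,
  identically distributed, symmetric and non-degenerate, and such a walk is almost surely unbounded
  above: arbitrarily long runs of increments \<open>\<ge> 1\<close> exclude that it is bounded on both sides, and by
  Kolmogorov's 0-1 law and symmetry it is unbounded in each direction with the same probability
  \<open>0\<close> or \<open>1\<close>. Left-arrows are treated in the mirror image.
\<close>

section \<open>Symmetric random walks on the real line\<close>

text \<open>Dropping the first \<open>N\<close> increments changes all later partial sums by the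
  same constant, so the event lies in the tail sigma-algebra and Kolmogorov's law applies.\<close>

lemma (in prob_space) walk_unbounded_0_1:
  fixes X :: "nat \<Rightarrow> 'a \<Rightarrow> real"
  assumes X: "indep_vars (\<lambda>_. borel) X UNIV"
  shows "prob {\<omega> \<in> space M. \<forall>C::nat. \<exists>n. real C < (\<Sum>k<n. X k \<omega>)} \<in> {0, 1}"
proof -
  let ?A = "{\<omega> \<in> space M. \<forall>C::nat. \<exists>n. real C < (\<Sum>k<n. X k \<omega>)}"
  let ?F = "\<lambda>i. sigma_sets (space M) {X i -` S \<inter> space M |S. S \<in> sets borel}"
  have "?A \<in> sigma_sets (space M) (\<Union> (?F ` {N..}))" for N
  proof -
    let ?N = "sigma (space M) (\<Union> (?F ` {N..}))"
    have F: "\<Union> (?F ` {N..}) \<subseteq> Pow (space M)"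
      by (auto dest: sigma_sets_into_sp[rotated])
    have [measurable]: "X (N + k) \<in> borel_measurable ?N" for k
    proof (rule measurableI)
      fix S :: "real set" assume "S \<in> sets borel"
      then have "X (N + k) -` S \<inter> space M \<in> ?F (N + k)" by blast
      then show "X (N + k) -` S \<inter> space ?N \<in> sets ?N"
        using F by (auto simp: space_measure_of intro!: sigma_sets.Basic UN_I[of "N + k"])
    qed simp
    \<comment> \<open>The right-hand side is the same event for the walk started after time
      \<open>N\<close>; it involves only the variables generating \<open>?N\<close>.\<close>
    have "?A = {\<omega> \<in> space ?N. \<forall>C::nat. \<exists>n. real C < (\<Sum>k<n. X (N + k) \<omega>)}" (is "_ = ?B")
    proof (intro set_eqI iffI)
      fix \<omega> assume A: "\<omega> \<in> ?A"
      have "\<exists>n. real C < (\<Sum>k<n. X (N + k) \<omega>)" for C :: nat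
      proof -
        \<comment> \<open>The absolute values bound every partial sum up to time \<open>N\<close>,
          so a sum exceeding \<open>C'\<close> has \<open>n > N\<close> and still exceeds
          \<open>C\<close> once the first \<open>N\<close> increments are removed.\<close>
        define C' where "C' = nat \<lceil>real C + (\<Sum>k<N. \<bar>X k \<omega>\<bar>)\<rceil>"
        have C': "real C + (\<Sum>k<N. \<bar>X k \<omega>\<bar>) \<le> real C'" unfolding C'_def by linarith
        obtain n where n: "real C' < (\<Sum>k<n. X k \<omega>)" using A by blast
        have le: "(\<Sum>k\<in>J. X k \<omega>) \<le> (\<Sum>k<N. \<bar>X k \<omega>\<bar>)" if "J \<subseteq> {..<N}" for J
        proof -
          have "(\<Sum>k\<in>J. X k \<omega>) \<le> (\<Sum>k\<in>J. \<bar>X k \<omega>\<bar>)" by (intro sum_mono) simp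
          also have "\<dots> \<le> (\<Sum>k<N. \<bar>X k \<omega>\<bar>)" using that by (intro sum_mono2) auto
          finally show ?thesis .
        qed
        have "n > N" using n C' le[of "{..<n}"] by (cases "n > N") auto
        then have "(\<Sum>k<n. X k \<omega>) = (\<Sum>k<N. X k \<omega>) + (\<Sum>k<n - N. X (N + k) \<omega>)"
          by (subst sum.atLeastLessThan_concat[of 0 N n "\<lambda>k. X k \<omega>", simplified atLeast0LessThan, symmetric])
             (auto simp: sum.atLeastLessThan_shift_0 atLeast0LessThan add.commute)
        then show ?thesis using n C' le[of "{..<N}"] by (intro exI[of _ "n - N"]) auto
      qed
      then show "\<omega> \<in> ?B" using A F by (auto simp: space_measure_of)
    next
      fix \<omega> assume B: "\<omega> \<in> ?B"
      have "\<exists>n. real C < (\<Sum>k<n. X k \<omega>)" for C :: nat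
      proof -
        define C' where "C' = nat \<lceil>real C + \<bar>\<Sum>k<N. X k \<omega>\<bar>\<rceil>"
        have C': "real C + \<bar>\<Sum>k<N. X k \<omega>\<bar> \<le> real C'" unfolding C'_def by linarith
        obtain n where n: "real C' < (\<Sum>k<n. X (N + k) \<omega>)" using B by blast
        have "(\<Sum>k<N + n. X k \<omega>) = (\<Sum>k<N. X k \<omega>) + (\<Sum>k<n. X (N + k) \<omega>)"
          by (subst sum.atLeastLessThan_concat[of 0 N "N + n" "\<lambda>k. X k \<omega>", simplified atLeast0LessThan, symmetric])
             (auto simp: sum.atLeastLessThan_shift_0 atLeast0LessThan add.commute)
        then show ?thesis using n C' by (intro exI[of _ "N + n"]) auto
      qed
      then show "\<omega> \<in> ?A" using B F by (auto simp: space_measure_of)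
    qed
    moreover have "?B \<in> sets ?N" by measurable
    ultimately show ?thesis using F by simp
  qed
  then have "?A \<in> tail_events ?F" by (auto simp: tail_events_def)
  moreover have "indep_sets ?F UNIV" using X by (simp add: indep_vars_def)
  moreover have "sigma_algebra (space M) (?F i)" for i
    by (rule sigma_algebra_sigma_sets) auto
  ultimately show ?thesis using kolmogorov_0_1_law[of ?F ?A] by auto
qed

text \<open>Under independence the law of the whole sequence is the product of its marginals, so
  symmetry of each increment lifts to the sequence. This allows comparing events that depend on
  infinitely many increments.\<close>

lemma (in prob_space) distr_sequence_uminus:
  fixes X :: "nat \<Rightarrow> 'a \<Rightarrow> real"
  assumes X: "indep_vars (\<lambda>_. borel) X UNIV"
    and sym: "\<And>k. distr M borel (X k) = distr M borel (\<lambda>\<omega>. - X k \<omega>)"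
  shows "distr M (Pi\<^sub>M UNIV (\<lambda>_. borel)) (\<lambda>\<omega> k. X k \<omega>)
       = distr M (Pi\<^sub>M UNIV (\<lambda>_. borel)) (\<lambda>\<omega> k. - X k \<omega>)"
proof -
  have [measurable]: "X k \<in> borel_measurable M" for k using X by (auto simp: indep_vars_def)
  have "indep_vars (\<lambda>_. borel) (\<lambda>k. uminus \<circ> X k) UNIV"
    by (rule indep_vars_compose[OF X]) simp
  then have Y: "indep_vars (\<lambda>_. borel) (\<lambda>k \<omega>. - X k \<omega>) UNIV" by (simp add: comp_def)
  show ?thesis
    using X Y sym by (simp add: indep_vars_iff_distr_eq_PiM restrict_UNIV)
qed

text \<open>Disjoint blocks of length \<open>K\<close> succeed independently, each with probability
  at least \<open>q ^ K\<close>, so the first \<open>n\<close> blocks all fail with probability at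
  most \<open>(1 - q ^ K) ^ n\<close>, which tends to 0.\<close>

lemma (in prob_space) long_run_AE:
  fixes X :: "nat \<Rightarrow> 'a \<Rightarrow> real"
  assumes X: "indep_vars (\<lambda>_. borel) X UNIV"
    and q: "q > 0" "\<And>k. prob {\<omega> \<in> space M. X k \<omega> \<ge> 1} \<ge> q"
  shows "AE \<omega> in M. \<exists>m. \<forall>k\<in>{m..<m+K}. X k \<omega> \<ge> 1"
proof -
  have [measurable]: "X k \<in> borel_measurable M" for k using X by (auto simp: indep_vars_def)
  define T where "T m \<omega> \<longleftrightarrow> (\<forall>k\<in>{m*K..<m*K+K}. X k \<omega> \<ge> 1)" for m \<omega>
  have [measurable]: "Measurable.pred M (T m)" for m unfolding T_def by measurable
  have q1: "q \<le> 1" using q(2)[of 0] by (meson order_trans prob_le_1)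
  have PT: "prob {\<omega> \<in> space M. T m \<omega>} \<ge> q ^ K" for m
  proof (cases "K = 0")
    case True then show ?thesis by (simp add: T_def prob_space)
  next
    case False
    have "{\<omega> \<in> space M. T m \<omega>} = (\<Inter>k\<in>{m*K..<m*K+K}. X k -` {1..} \<inter> space M)"
      using False by (auto simp: T_def)
    also have "prob \<dots> = (\<Prod>k\<in>{m*K..<m*K+K}. prob (X k -` {1..} \<inter> space M))"
      using False by (intro indep_varsD[OF X]) auto
    also have "\<dots> \<ge> (\<Prod>k\<in>{m*K..<m*K+K}. q)"
      using q by (intro prod_mono) (auto simp: vimage_def Int_def conj_commute less_imp_le)
    finally show ?thesis by simp
  qed
  have disj: "disjoint_family_on (\<lambda>m. {m*K..<m*K+K}) UNIV"
  proof (unfold disjoint_family_on_def, intro ballI impI)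
    fix m n :: nat assume "m \<noteq> n"
    moreover have "k div K = m" if "k \<in> {m*K..<m*K+K}" for k m
      using that by (intro div_nat_eqI) (auto simp: algebra_simps)
    ultimately show "{m*K..<m*K+K} \<inter> {n*K..<n*K+K} = {}" by blast
  qed
  \<comment> \<open>\<open>T m\<close> is a function of the increments in the \<open>m\<close>-th
    block, so independence of the \<open>T m\<close> follows from that of the restrictions to
    disjoint blocks.\<close>
  have "indep_vars (\<lambda>m. PiM {m*K..<m*K+K} (\<lambda>_. borel)) (\<lambda>m \<omega>. restrict (\<lambda>k. X k \<omega>) {m*K..<m*K+K}) UNIV"
    by (rule indep_vars_restrict[OF X _ disj]) auto
  then have "indep_vars (\<lambda>m. count_space UNIV)
     (\<lambda>m. (\<lambda>f. \<forall>k\<in>{m*K..<m*K+K}. f k \<ge> 1) \<circ> (\<lambda>\<omega>. restrict (\<lambda>k. X k \<omega>) {m*K..<m*K+K})) UNIV"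
    by (rule indep_vars_compose) measurable
  then have indT: "indep_vars (\<lambda>m. count_space UNIV) T UNIV"
    by (rule indep_vars_cong[THEN iffD1, rotated -1]) (auto simp: T_def fun_eq_iff)
  have bound: "prob {\<omega> \<in> space M. \<forall>m. \<not> T m \<omega>} \<le> (1 - q ^ K) ^ n" for n
  proof (cases "n = 0")
    case False
    have "prob {\<omega> \<in> space M. \<forall>m. \<not> T m \<omega>} \<le> prob (\<Inter>m\<in>{..<n}. T m -` {False} \<inter> space M)"
      using False
      by (intro finite_measure_mono sets.finite_INT measurable_sets[of _ _ "count_space UNIV"]) auto
    also have "\<dots> = (\<Prod>m<n. prob (T m -` {False} \<inter> space M))"
      using False by (intro indep_varsD[OF indT]) auto
    also have "\<dots> \<le> (\<Prod>m<n. 1 - q ^ K)"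
    proof (intro prod_mono conjI)
      fix m
      have "prob (T m -` {False} \<inter> space M) = 1 - prob {\<omega> \<in> space M. T m \<omega>}"
        by (subst prob_neg[symmetric]) (auto intro!: arg_cong[where f=prob])
      then show "prob (T m -` {False} \<inter> space M) \<le> 1 - q ^ K" using PT[of m] by simp
    qed simp
    finally show ?thesis by simp
  qed simp
  have "(\<lambda>n. (1 - q ^ K) ^ n) \<longlonglongrightarrow> 0"
    using q q1 by (intro LIMSEQ_realpow_zero) (auto simp: power_le_one)
  then have "prob {\<omega> \<in> space M. \<forall>m. \<not> T m \<omega>} \<le> 0"
    by (rule LIMSEQ_le_const) (use bound in auto)
  then have "prob {\<omega> \<in> space M. \<forall>m. \<not> T m \<omega>} = 0" by (simp add: measure_le_0_iff)
  then have "AE \<omega> in M. \<not> (\<forall>m. \<not> T m \<omega>)"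
    by (subst (asm) prob_eq_0) auto
  then show ?thesis by (rule AE_mp) (auto simp: T_def)
qed

text \<open>Unboundedness above of the walk and of its negative are equally likely, and at least one
  of them occurs almost surely. Hence the first is not null, and the 0-1 law gives it probability
  1.\<close>

lemma (in prob_space) symmetric_walk_unbounded:
  fixes X :: "nat \<Rightarrow> 'a \<Rightarrow> real"
  assumes X: "indep_vars (\<lambda>_. borel) X UNIV"
    and sym: "\<And>k. distr M borel (X k) = distr M borel (\<lambda>\<omega>. - X k \<omega>)"
    and q: "q > 0" "\<And>k. prob {\<omega> \<in> space M. X k \<omega> \<ge> 1} \<ge> q"
  shows "AE \<omega> in M. \<forall>C::nat. \<exists>n. real C < (\<Sum>k<n. X k \<omega>)"
proof -
  have [measurable]: "X k \<in> borel_measurable M" for k using X by (auto simp: indep_vars_def)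
  \<comment> \<open>A predicate on sequences, so that it can be evaluated under the laws of the
    increments and of their negatives.\<close>
  define U where "U f \<longleftrightarrow> (\<forall>C::nat. \<exists>n. real C < (\<Sum>k<n. f k))" for f :: "nat \<Rightarrow> real"
  let ?S = "Pi\<^sub>M UNIV (\<lambda>_::nat. borel :: real measure)"
  have [measurable]: "Measurable.pred ?S U" unfolding U_def by measurable
  have U: "{f \<in> space ?S. U f} \<in> sets ?S" by measurable
  have eq: "prob {\<omega> \<in> space M. U (\<lambda>k. X k \<omega>)} = prob {\<omega> \<in> space M. U (\<lambda>k. - X k \<omega>)}"
  proof -
    have "measure (distr M ?S (\<lambda>\<omega> k. X k \<omega>)) {f \<in> space ?S. U f}
        = measure (distr M ?S (\<lambda>\<omega> k. - X k \<omega>)) {f \<in> space ?S. U f}"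
      using distr_sequence_uminus[OF X sym] by simp
    then show ?thesis
      by (subst (asm) (1 2) measure_distr)
         (auto intro!: measurable_PiM_single' U[simplified space_PiM, simplified] simp: space_PiM vimage_def Int_def conj_commute)
  qed
  have "AE \<omega> in M. \<forall>K. \<exists>m. \<forall>k\<in>{m..<m+K}. X k \<omega> \<ge> 1"
    using long_run_AE[OF X q] by (simp add: AE_all_countable)
  then have or: "AE \<omega> in M. U (\<lambda>k. X k \<omega>) \<or> U (\<lambda>k. - X k \<omega>)"
  proof (rule AE_mp, intro AE_I2 impI)
    fix \<omega> assume run: "\<forall>K. \<exists>m. \<forall>k\<in>{m..<m+K}. X k \<omega> \<ge> 1"
    show "U (\<lambda>k. X k \<omega>) \<or> U (\<lambda>k. - X k \<omega>)"
    proof (rule ccontr)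
      assume "\<not> ?thesis"
      then obtain C C' :: nat where C: "\<And>n. (\<Sum>k<n. X k \<omega>) \<le> real C"
        and C': "\<And>n. - (\<Sum>k<n. X k \<omega>) \<le> real C'"
        unfolding U_def sum_negf by (meson not_less)
      \<comment> \<open>One more than the height of a strip containing the walk: a run of
        \<open>K\<close> increments of size at least 1 would leave it.\<close>
      define K where "K = C + C' + 1"
      obtain m where m: "\<forall>k\<in>{m..<m+K}. X k \<omega> \<ge> 1" using run by blast
      have "real K = (\<Sum>k\<in>{m..<m+K}. 1)" by simp
      also have "\<dots> \<le> (\<Sum>k\<in>{m..<m+K}. X k \<omega>)" using m by (intro sum_mono) auto
      also have "\<dots> = (\<Sum>k<m+K. X k \<omega>) - (\<Sum>k<m. X k \<omega>)"
        using sum.atLeastLessThan_concat[of 0 m "m+K" "\<lambda>k. X k \<omega>"] by (simp add: atLeast0LessThan)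
      also have "\<dots> \<le> real C + real C'" using C[of "m+K"] C'[of m] by linarith
      finally show False by (simp add: K_def)
    qed
  qed
  have "prob {\<omega> \<in> space M. U (\<lambda>k. X k \<omega>)} \<noteq> 0"
  proof
    assume 0: "prob {\<omega> \<in> space M. U (\<lambda>k. X k \<omega>)} = 0"
    have "AE \<omega> in M. \<not> U (\<lambda>k. X k \<omega>)"
      using 0 by (simp add: prob_Collect_eq_0 U_def)
    moreover have "AE \<omega> in M. \<not> U (\<lambda>k. - X k \<omega>)"
      using 0[unfolded eq] by (simp add: prob_Collect_eq_0 U_def del: sum_negf)
    ultimately have "AE \<omega> in M. False" using or by eventually_elim auto
    then show False by simp
  qed
  then have "prob {\<omega> \<in> space M. U (\<lambda>k. X k \<omega>)} = 1"
    using walk_unbounded_0_1[OF X] by (simp add: U_def)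
  then have "AE \<omega> in M. U (\<lambda>k. X k \<omega>)"
    by (subst (asm) prob_Collect_eq_1) (auto simp: U_def)
  then show ?thesis by (simp add: U_def)
qed

section \<open>Counting arrows in the pairing\<close>

lemma finite_free_right: "finite (free_right R E i)"
  and finite_free_left: "finite (free_left L E i)"
  by (simp_all add: free_right_def free_left_def)

text \<open>The distance bound is what confines the partners to a finite window in the counting
  arguments below.\<close>

lemma edges_upto_bounds:
  assumes "((i, j), (i', j')) \<in> edges_upto R L n"
  shows "i < i'" "i' \<le> i + int n" "j \<in> {1..R i}" "j' \<in> {1..L i'}"
proof -
  have "i < i' \<and> i' \<le> i + int n \<and> j \<in> {1..R i} \<and> j' \<in> {1..L i'}"
    using assms
  proof (induction n)
    case (Suc n)
    show ?case
    proof (cases "((i, j), (i', j')) \<in> edges_upto R L n")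
      case True then show ?thesis using Suc.IH by force
    next
      case False
      let ?A = "free_right R (edges_upto R L n) i" and ?B = "free_left L (edges_upto R L n) i'"
      obtain m where m: "i' = i + int (Suc n)" "m < card ?A" "m < card ?B"
          "j = sorted_list_of_set ?A ! m" "j' = sorted_list_of_set ?B ! m"
        using False Suc.prems unfolding edges_upto.simps new_edges_def by auto
      have "j \<in> ?A" "j' \<in> ?B" using m set_sorted_nth by metis+
      then show ?thesis using m(1) by (simp add: free_right_def free_left_def)
    qed
  qed simp
  then show "i < i'" "i' \<le> i + int n" "j \<in> {1..R i}" "j' \<in> {1..L i'}" by blast+
qed

text \<open>Step \<open>n\<close> is greedy: it joins as many pairs as the smaller of the two free
  sets allows. This exhausts that set, and no arrow becomes free again.\<close>

lemma free_right_or_left_empty: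
  assumes "n > 0"
  shows "free_right R (edges_upto R L n) i = {} \<or> free_left L (edges_upto R L n) (i + int n) = {}"
proof -
  \<comment> \<open>The edges present just before step \<open>n\<close> are those after step
    \<open>m\<close>; steps are numbered from 1.\<close>
  obtain m where n: "n = Suc m" using assms by (cases n) auto
  let ?E = "edges_upto R L m" and ?i' = "i + int n"
  let ?A = "free_right R ?E i" and ?B = "free_left L ?E ?i'"
  have new: "((i, sorted_list_of_set ?A ! k), (?i', sorted_list_of_set ?B ! k)) \<in> edges_upto R L n"
    if "k < card ?A" "k < card ?B" for k
    using that unfolding n edges_upto.simps new_edges_def by auto
  \<comment> \<open>Every free label occupies some position of the sorted list, so it suffices that
    each position of the smaller set is matched.\<close>
  have nth: "\<exists>k<card S. a = sorted_list_of_set S ! k" if "finite S" "a \<in> S" for S and a :: nat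
    using that by (metis in_set_conv_nth sorted_list_of_set.length_sorted_key_list_of_set set_sorted_list_of_set)
  have sub: "free_right R (edges_upto R L n) i \<subseteq> ?A" "free_left L (edges_upto R L n) ?i' \<subseteq> ?B"
    unfolding n free_right_def free_left_def by auto
  show ?thesis
  proof (cases "card ?A \<le> card ?B")
    case True
    have "(i, j) \<in> Domain (edges_upto R L n)" if "j \<in> ?A" for j
    proof -
      obtain k where k: "k < card ?A" "j = sorted_list_of_set ?A ! k"
        using nth[OF finite_free_right \<open>j \<in> ?A\<close>] by blast
      then have "k < card ?B" using True by linarith
      then show ?thesis using new[of k] k by blast
    qed
    then show ?thesis using sub(1) by (auto simp: free_right_def)
  next
    case False
    have "(?i', j) \<in> Range (edges_upto R L n)" if "j \<in> ?B" for j
    proof -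
      obtain k where k: "k < card ?B" "j = sorted_list_of_set ?B ! k"
        using nth[OF finite_free_left \<open>j \<in> ?B\<close>] by blast
      then have "k < card ?A" using False by linarith
      then show ?thesis using new[of k] k by blast
    qed
    then show ?thesis using sub(2) by (auto simp: free_left_def)
  qed
qed

text \<open>As long as the right-arrow \<open>j\<close> at 0 is free, no left-arrow at
  \<open>k > 0\<close> is free after step \<open>k\<close>, by
  \<open>free_right_or_left_empty\<close>. Its partner then sits in \<open>{0..<k}\<close>, and
  since the edges form a matching, this injects the left-arrows over \<open>{1..int n}\<close> into
  the right-arrows over \<open>{0..<int n}\<close>.\<close>

lemma sum_left_le_sum_right:
  assumes j: "j \<in> {1..R 0}" "(0, j) \<notin> Domain (sprd_edges R L)"
  shows "(\<Sum>i\<in>{1..int n}. L i) \<le> (\<Sum>i\<in>{0..<int n}. R i)"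
proof -
  let ?A = "Sigma {1..int n} (\<lambda>i. {1..L i})" and ?B = "Sigma {0..<int n} (\<lambda>i. {1..R i})"
  have "card ?A \<le> card ?B"
  proof (rule card_le_if_inj_on_rel[where r = "\<lambda>y x. (x, y) \<in> sprd_edges R L"])
    fix y assume "y \<in> ?A"
    then obtain i l where y: "y = (i, l)" "1 \<le> i" "i \<le> int n" "l \<in> {1..L i}" by auto
    define k where "k = nat i"
    have k: "i = int k" "k > 0" using y by (auto simp: k_def)
    have "j \<in> free_right R (edges_upto R L k) 0"
      using j by (auto simp: free_right_def sprd_edges_def)
    then have "free_left L (edges_upto R L k) i = {}"
      using free_right_or_left_empty[OF k(2), of R L 0] k(1) by auto
    then obtain x where x: "(x, y) \<in> edges_upto R L k"
      using y by (auto simp: free_left_def)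
    \<comment> \<open>The partner was found within \<open>k\<close> steps and
      \<open>i = int k\<close>, so its vertex is non-negative and strictly below
      \<open>i\<close>.\<close>
    then have "x \<in> ?B"
      using edges_upto_bounds[of "fst x" "snd x" "fst y" "snd y" R L k] y k by (cases x) auto
    moreover have "(x, y) \<in> sprd_edges R L" using x by (auto simp: sprd_edges_def)
    ultimately show "\<exists>x. x \<in> ?B \<and> (x, y) \<in> sprd_edges R L" by blast
  next
    fix y y' x assume "(x, y) \<in> sprd_edges R L" "(x, y') \<in> sprd_edges R L"
    then show "y = y'" using sprd_edges_matching[of R L] by (meson single_valuedD)
  qed auto
  then show ?thesis by simp
qed

text \<open>Mirror image: an unconnected left-arrow at 0 forces each right-arrow at
  \<open>-k\<close> to find its partner in \<open>{-k<..0}\<close>.\<close>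

lemma sum_right_le_sum_left:
  assumes j: "j \<in> {1..L 0}" "(0, j) \<notin> Range (sprd_edges R L)"
  shows "(\<Sum>i\<in>{-int n..-1}. R i) \<le> (\<Sum>i\<in>{-int n<..0}. L i)"
proof -
  let ?A = "Sigma {-int n..-1} (\<lambda>i. {1..R i})" and ?B = "Sigma {-int n<..0} (\<lambda>i. {1..L i})"
  have "card ?A \<le> card ?B"
  proof (rule card_le_if_inj_on_rel[where r = "\<lambda>x y. (x, y) \<in> sprd_edges R L"])
    fix x assume "x \<in> ?A"
    then obtain i r where x: "x = (i, r)" "-int n \<le> i" "i \<le> -1" "r \<in> {1..R i}" by auto
    define k where "k = nat (-i)"
    have k: "i = -int k" "k > 0" using x by (auto simp: k_def)
    have "j \<in> free_left L (edges_upto R L k) 0"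
      using j by (auto simp: free_left_def sprd_edges_def)
    then have "free_right R (edges_upto R L k) i = {}"
      using free_right_or_left_empty[OF k(2), of R L i] k(1) by auto
    then obtain y where y: "(x, y) \<in> edges_upto R L k"
      using x by (auto simp: free_right_def)
    then have "y \<in> ?B"
      using edges_upto_bounds[of "fst x" "snd x" "fst y" "snd y" R L k] x k by (cases y) auto
    moreover have "(x, y) \<in> sprd_edges R L" using y by (auto simp: sprd_edges_def)
    ultimately show "\<exists>y. y \<in> ?B \<and> (x, y) \<in> sprd_edges R L" by blast
  next
    fix x x' y assume "(x, y) \<in> sprd_edges R L" "(x', y) \<in> sprd_edges R L"
    then show "x = x'" using sprd_edges_matching[of R L] by (meson single_valuedD converse_iff)
  qed auto
  then show ?thesis by simp
qed

section \<open>Finiteness of the maximal length\<close>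

lemma SUP_enat_less_infinity_iff:
  fixes f :: "'b \<Rightarrow> enat"
  assumes "finite A"
  shows "(SUP x\<in>A. f x) < \<infinity> \<longleftrightarrow> (\<forall>x\<in>A. f x < \<infinity>)"
  using assms by (induction A rule: finite_induct) (simp_all add: sup_enat_def bot_enat_def del: enat_ord_simps)

lemma INF_enat_less_infinity_iff: "(INF x\<in>A. enat (f x)) < \<infinity> \<longleftrightarrow> A \<noteq> {}"
  unfolding INF_less_iff by auto

text \<open>The lengths are infima of natural numbers, infinite exactly over the empty set, and only
  finitely many are maximised; so finiteness becomes a statement about which arrows are
  connected.\<close>

lemma max_length_less_infinity_iff:
  "max_length R L < \<infinity> \<longleftrightarrow> (\<forall>j\<in>{1..R 0}. (0, j) \<in> Domain (sprd_edges R L))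
     \<and> (\<forall>j\<in>{1..L 0}. (0, j) \<in> Range (sprd_edges R L))"
proof -
  have "length_right R L j < \<infinity> \<longleftrightarrow> (0, j) \<in> Domain (sprd_edges R L)" for j
    unfolding length_right_def INF_enat_less_infinity_iff by (auto simp: Domain_iff)
  moreover have "length_left R L j < \<infinity> \<longleftrightarrow> (0, j) \<in> Range (sprd_edges R L)" for j
    unfolding length_left_def INF_enat_less_infinity_iff by (auto simp: Range_iff)
  ultimately show ?thesis
    unfolding max_length_def max_less_iff_conj by (simp only: SUP_enat_less_infinity_iff finite_atLeastAtMost)
qed

text \<open>The deterministic core: an unconnected right-arrow at 0 would bound the walk to the
  right by \<open>R 0\<close>, and an unconnected left-arrow would bound the walk to the left by
  \<open>L 0\<close>.\<close>

lemma max_length_less_infinity: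
  assumes up: "\<And>C::nat. \<exists>n. real C < (\<Sum>k<n. real (L (int k + 1)) - real (R (int k + 1)))"
    and down: "\<And>C::nat. \<exists>n. real C < (\<Sum>k<n. real (R (- int k - 1)) - real (L (- int k - 1)))"
  shows "max_length R L < \<infinity>"
proof -
  have "(0, j) \<in> Domain (sprd_edges R L)" if j: "j \<in> {1..R 0}" for j
  proof (rule ccontr)
    assume "(0, j) \<notin> Domain (sprd_edges R L)"
    note le = sum_left_le_sum_right[of j R L, OF j this]
    obtain n where n: "real (R 0) < (\<Sum>k<n. real (L (int k + 1)) - real (R (int k + 1)))"
      using up by blast
    have shift: "(\<Sum>k<n. f (int k + 1)) = (\<Sum>i\<in>{1..int n}. f i)" for f :: "int \<Rightarrow> nat"
      by (rule sum.reindex_bij_witness[of _ "\<lambda>i. nat (i - 1)" "\<lambda>k. int k + 1"]) auto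
    \<comment> \<open>Allowing the vertex \<open>n\<close> as well makes both sums run over
      \<open>1\<close> to \<open>n\<close>, with the vertex 0 split off to give the bound
      \<open>R 0\<close>.\<close>
    have "(\<Sum>i\<in>{0..<int n}. R i) \<le> (\<Sum>i\<in>insert 0 {1..int n}. R i)"
      by (intro sum_mono2) auto
    then have "(\<Sum>k<n. L (int k + 1)) \<le> R 0 + (\<Sum>k<n. R (int k + 1))"
      using le[of n] by (simp add: shift)
    then have "real (\<Sum>k<n. L (int k + 1)) \<le> real (R 0 + (\<Sum>k<n. R (int k + 1)))"
      by (rule of_nat_mono)
    with n show False by (simp add: sum_subtractf)
  qed
  moreover have "(0, j) \<in> Range (sprd_edges R L)" if j: "j \<in> {1..L 0}" for j
  proof (rule ccontr)
    assume "(0, j) \<notin> Range (sprd_edges R L)"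
    note le = sum_right_le_sum_left[of j L R, OF j this]
    obtain n where n: "real (L 0) < (\<Sum>k<n. real (R (- int k - 1)) - real (L (- int k - 1)))"
      using down by blast
    have shift: "(\<Sum>k<n. f (- int k - 1)) = (\<Sum>i\<in>{-int n..-1}. f i)" for f :: "int \<Rightarrow> nat"
      by (rule sum.reindex_bij_witness[of _ "\<lambda>i. nat (- i - 1)" "\<lambda>k. - int k - 1"]) auto
    have "(\<Sum>i\<in>{-int n<..0}. L i) \<le> (\<Sum>i\<in>insert 0 {-int n..-1}. L i)"
      by (intro sum_mono2) auto
    then have "(\<Sum>k<n. R (- int k - 1)) \<le> L 0 + (\<Sum>k<n. L (- int k - 1))"
      using le[of n] by (simp add: shift)
    then have "real (\<Sum>k<n. R (- int k - 1)) \<le> real (L 0 + (\<Sum>k<n. L (- int k - 1)))"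
      by (rule of_nat_mono)
    with n show False by (simp add: sum_subtractf)
  qed
  ultimately show ?thesis unfolding max_length_less_infinity_iff by blast
qed

section \<open>Measurability of the event\<close>

text \<open>A countable type has only countably many finite subsets, so the event splits into
  countably many events that fix the value of \<open>A\<close>. This handles arbitrary
  \<open>P\<close>, such as conditions on the cardinality and the sorted list of free
  labels.\<close>

lemma pred_finite_set_valued:
  fixes A :: "'a \<Rightarrow> 'b::countable set"
  assumes fin: "\<And>\<omega>. finite (A \<omega>)" and [measurable]: "\<And>j. Measurable.pred M (\<lambda>\<omega>. j \<in> A \<omega>)"
  shows "Measurable.pred M (\<lambda>\<omega>. P (A \<omega>))"
proof -
  have "{\<omega> \<in> space M. P (A \<omega>)}
      = (\<Union>S\<in>{S. finite S \<and> P S}. {\<omega> \<in> space M. \<forall>j. j \<in> A \<omega> \<longleftrightarrow> j \<in> S})"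
    using fin by (auto simp: set_eq_iff[symmetric])
  also have "\<dots> \<in> sets M"
  proof (rule sets.countable_UN')
    show "countable {S :: 'b set. finite S \<and> P S}"
      by (rule countable_subset[OF _ countable_Collect_finite]) auto
    show "(\<lambda>S. {\<omega> \<in> space M. \<forall>j. j \<in> A \<omega> \<longleftrightarrow> j \<in> S}) ` {S. finite S \<and> P S} \<subseteq> sets M"
      by (intro image_subsetI) measurable
  qed
  finally show ?thesis by (simp add: pred_def)
qed

lemma pred_in_edges_upto:
  fixes R L :: "'a \<Rightarrow> int \<Rightarrow> nat"
  assumes [measurable]: "\<And>i. (\<lambda>\<omega>. R \<omega> i) \<in> measurable M (count_space UNIV)"
    "\<And>i. (\<lambda>\<omega>. L \<omega> i) \<in> measurable M (count_space UNIV)"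
  shows "Measurable.pred M (\<lambda>\<omega>. e \<in> edges_upto (R \<omega>) (L \<omega>) n)"
proof (induction n arbitrary: e)
  case (Suc n)
  note Suc[measurable]
  let ?A = "\<lambda>i \<omega>. free_right (R \<omega>) (edges_upto (R \<omega>) (L \<omega>) n) i"
  let ?B = "\<lambda>i \<omega>. free_left (L \<omega>) (edges_upto (R \<omega>) (L \<omega>) n) i"
  have "Measurable.pred M (\<lambda>\<omega>. j \<in> ?A i \<omega>)" for i j
    unfolding free_right_def mem_Collect_eq Domain_iff atLeastAtMost_iff by measurable
  note A[measurable] = pred_finite_set_valued[OF finite_free_right this]
  have "Measurable.pred M (\<lambda>\<omega>. j \<in> ?B i \<omega>)" for i j
    unfolding free_left_def mem_Collect_eq Range_iff atLeastAtMost_iff by measurable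
  note B[measurable] = pred_finite_set_valued[OF finite_free_left this]
  obtain i j i' j' where e: "e = ((i, j), (i', j'))" by (cases e) auto
  \<comment> \<open>The conjuncts under the quantifier are grouped so that each depends on a single
    random finite set, the form to which \<open>A\<close> and \<open>B\<close> apply.\<close>
  have "(\<lambda>\<omega>. e \<in> edges_upto (R \<omega>) (L \<omega>) (Suc n)) = (\<lambda>\<omega>. e \<in> edges_upto (R \<omega>) (L \<omega>) n \<or>
      i' = i + int (Suc n) \<and> (\<exists>m. (m < card (?A i \<omega>) \<and> sorted_list_of_set (?A i \<omega>) ! m = j) \<and>
        (m < card (?B i' \<omega>) \<and> sorted_list_of_set (?B i' \<omega>) ! m = j')))"
    unfolding e edges_upto.simps new_edges_def by auto
  also have "Measurable.pred M \<dots>"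
    by (intro pred_intros_logic pred_intros_countable A B Suc)
  finally show ?case .
qed simp

lemma pred_max_length_less_infinity:
  fixes R L :: "'a \<Rightarrow> int \<Rightarrow> nat"
  assumes [measurable]: "\<And>i. (\<lambda>\<omega>. R \<omega> i) \<in> measurable M (count_space UNIV)"
    "\<And>i. (\<lambda>\<omega>. L \<omega> i) \<in> measurable M (count_space UNIV)"
  shows "Measurable.pred M (\<lambda>\<omega>. max_length (R \<omega>) (L \<omega>) < \<infinity>)"
proof -
  note pred_in_edges_upto[OF assms, measurable]
  have "(\<lambda>\<omega>. max_length (R \<omega>) (L \<omega>) < \<infinity>) = (\<lambda>\<omega>.
      (\<forall>j. 1 \<le> j \<and> j \<le> R \<omega> 0 \<longrightarrow> (\<exists>n y. ((0, j), y) \<in> edges_upto (R \<omega>) (L \<omega>) n)) \<and>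
      (\<forall>j. 1 \<le> j \<and> j \<le> L \<omega> 0 \<longrightarrow> (\<exists>n x. (x, (0, j)) \<in> edges_upto (R \<omega>) (L \<omega>) n)))"
    unfolding max_length_less_infinity_iff sprd_edges_def by (fastforce simp: Domain_iff Range_iff)
  also have "Measurable.pred M \<dots>" by measurable
  finally show ?thesis .
qed

section \<open>Independence of the walk increments\<close>

text \<open>A finite intersection splits into a part in \<open>sets A\<close> and a part in
  \<open>sets B\<close>. Independence of the two sigma-algebras factorises it, and independence
  within each family does the rest. This serves to merge degrees and coins.\<close>

lemma (in prob_space) indep_vars_case_sum:
  fixes X :: "'i \<Rightarrow> 'a \<Rightarrow> 'b" and Y :: "'j \<Rightarrow> 'a \<Rightarrow> 'b"
  assumes X: "indep_vars (\<lambda>_. N) X UNIV" and Y: "indep_vars (\<lambda>_. N) Y UNIV"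
    and indep: "indep_set (sets A) (sets B)" and space: "space A = space M" "space B = space M"
    and XA: "\<And>i. X i \<in> measurable A N" and YB: "\<And>j. Y j \<in> measurable B N"
  shows "indep_vars (\<lambda>_. N) (case_sum X Y) UNIV"
  unfolding indep_vars_def2
proof (intro conjI ballI indep_setsI)
  let ?F = "\<lambda>z. {case_sum X Y z -` S \<inter> space M |S. S \<in> sets N}"
  show rv: "random_variable N (case_sum X Y z)" for z
    using X Y by (cases z) (auto simp: indep_vars_def)
  show "?F z \<subseteq> events" for z
    using rv[of z] by (auto dest: measurable_sets)
  fix C and J :: "('i + 'j) set"
  assume J: "J \<noteq> {}" "finite J" "\<forall>z\<in>J. C z \<in> ?F z"
  define J1 J2 where "J1 = Inl -` J" and "J2 = Inr -` J"
  have J12: "J = Inl ` J1 \<union> Inr ` J2" unfolding J1_def J2_def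
    by (auto simp: image_iff) (metis sum.exhaust)
  have fin: "finite J1" "finite J2"
    using J(2) unfolding J1_def J2_def by (auto intro: finite_vimageI)
  have C1: "C (Inl i) \<in> {X i -` S \<inter> space M |S. S \<in> sets N}" if "i \<in> J1" for i
    using J(3) that unfolding J1_def by fastforce
  have C2: "C (Inr i) \<in> {Y i -` S \<inter> space M |S. S \<in> sets N}" if "i \<in> J2" for i
    using J(3) that unfolding J2_def by fastforce
  \<comment> \<open>Intersecting with \<open>space M\<close> yields the whole space, of probability
    1, when \<open>J1\<close> or \<open>J2\<close> is empty.\<close>
  define a b where "a = space M \<inter> (\<Inter>i\<in>J1. C (Inl i))" and "b = space M \<inter> (\<Inter>i\<in>J2. C (Inr i))"
  have pa: "prob a = (\<Prod>i\<in>J1. prob (C (Inl i)))"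
  proof (cases "J1 = {}")
    case False
    then have "a = (\<Inter>i\<in>J1. C (Inl i))" using C1 unfolding a_def by blast
    then show ?thesis
      using indep_setsD[of "\<lambda>i. {X i -` S \<inter> space M |S. S \<in> sets N}" UNIV J1 "\<lambda>i. C (Inl i)"]
        X False fin C1 unfolding indep_vars_def2 by blast
  qed (simp add: a_def prob_space)
  have pb: "prob b = (\<Prod>i\<in>J2. prob (C (Inr i)))"
  proof (cases "J2 = {}")
    case False
    then have "b = (\<Inter>i\<in>J2. C (Inr i))" using C2 unfolding b_def by blast
    then show ?thesis
      using indep_setsD[of "\<lambda>i. {Y i -` S \<inter> space M |S. S \<in> sets N}" UNIV J2 "\<lambda>i. C (Inr i)"]
        Y False fin C2 unfolding indep_vars_def2 by blast
  qed (simp add: b_def prob_space)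
  have "C (Inl i) \<in> sets A" if "i \<in> J1" for i
    using C1[OF that] measurable_sets[OF XA] space by auto
  then have a: "a \<in> sets A"
    using fin sets.top[of A] sets.finite_INT[of J1 "\<lambda>i. C (Inl i)" A] unfolding a_def space(1)[symmetric]
    by (cases "J1 = {}") (auto intro: sets.Int)
  have "C (Inr i) \<in> sets B" if "i \<in> J2" for i
    using C2[OF that] measurable_sets[OF YB] space by auto
  then have b: "b \<in> sets B"
    using fin sets.top[of B] sets.finite_INT[of J2 "\<lambda>i. C (Inr i)" B] unfolding b_def space(2)[symmetric]
    by (cases "J2 = {}") (auto intro: sets.Int)
  have "C z \<subseteq> space M" if "z \<in> J" for z
    using J(3) that by blast
  then have "(\<Inter>z\<in>J. C z) = a \<inter> b"
    using J(1) unfolding a_def b_def J12 by blast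
  then have "prob (\<Inter>z\<in>J. C z) = prob a * prob b"
    using indep_setD[OF indep a b] by simp
  also have "\<dots> = (\<Prod>z\<in>J. prob (C z))"
    unfolding pa pb J12 using fin by (subst prod.union_disjoint) (auto simp: prod.reindex)
  finally show "prob (\<Inter>z\<in>J. C z) = (\<Prod>z\<in>J. prob (C z))" .
qed

text \<open>
  Degrees and coins form one independent family of naturals: \<open>Inl i\<close> stands for the degree of \<open>i\<close>,
  \<open>Inr (i, k)\<close> for the coin of the stub \<open>k\<close> at \<open>i\<close>.
\<close>

definition stub_data :: "(int \<Rightarrow> 'a \<Rightarrow> nat) \<Rightarrow> (int \<Rightarrow> nat \<Rightarrow> 'a \<Rightarrow> bool) \<Rightarrow> int + int \<times> nat \<Rightarrow> 'a \<Rightarrow> nat" where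
  "stub_data D B = case_sum D (\<lambda>(i, k) \<omega>. of_bool (B i k \<omega>))"

text \<open>Blocks of distinct vertices are disjoint, which makes the increments of the walk
  independent.\<close>

definition stub_block :: "int \<Rightarrow> (int + int \<times> nat) set" where
  "stub_block i = insert (Inl i) (range (\<lambda>k. Inr (i, k)))"

text \<open>This is the increment \<open>L i - R i\<close>, written as a function of the combined
  family so that its law is determined by a product measure. The coin value 0 encodes a
  left-arrow.\<close>

definition left_excess :: "int \<Rightarrow> (int + int \<times> nat \<Rightarrow> nat) \<Rightarrow> real" where
  "left_excess i f = (\<Sum>k<f (Inl i). if f (Inr (i, k)) = 0 then 1 else - 1)"

lemma measurable_left_excess:
  assumes "stub_block i \<subseteq> K"
  shows "left_excess i \<in> borel_measurable (Pi\<^sub>M K (\<lambda>_. count_space UNIV))"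
proof -
  have [measurable]: "(\<lambda>f. f (Inl i)) \<in> measurable (Pi\<^sub>M K (\<lambda>_. count_space UNIV)) (count_space (UNIV :: nat set))"
    "(\<lambda>f. f (Inr (i, k))) \<in> measurable (Pi\<^sub>M K (\<lambda>_. count_space UNIV)) (count_space (UNIV :: nat set))" for k
    using assms by (auto simp: stub_block_def intro!: measurable_component_singleton)
  show ?thesis unfolding left_excess_def[abs_def]
    \<comment> \<open>The number of summands is random; splitting over its countably many values
      leaves sums of fixed length.\<close>
    by (rule measurable_compose_countable[where g = "\<lambda>f. f (Inl i)"]) measurable
qed

lemma left_excess_cong:
  "(\<And>z. z \<in> stub_block i \<Longrightarrow> f z = g z) \<Longrightarrow> left_excess i f = left_excess i g"
  by (auto simp: left_excess_def stub_block_def)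

lemma left_excess_stub_data:
  "left_excess i (\<lambda>z. stub_data D B z \<omega>) = real (num_left D B \<omega> i) - real (num_right D B \<omega> i)"
proof -
  have card: "real (card {k. k < d \<and> P k}) = (\<Sum>k<d. of_bool (P k))" for d :: nat and P
    by (simp add: Int_def lessThan_def)
  show ?thesis
    unfolding left_excess_def stub_data_def num_left_def num_right_def card sum_subtractf[symmetric]
    by (auto intro!: sum.cong)
qed

text \<open>Flipping every coin exchanges the two directions. This reduces symmetry of the
  increments to symmetry of the coins.\<close>

lemma left_excess_flip:
  "left_excess i (\<lambda>z. stub_data D (\<lambda>i k \<omega>. \<not> B i k \<omega>) z \<omega>) = - left_excess i (\<lambda>z. stub_data D B z \<omega>)"
  unfolding left_excess_def stub_data_def by (auto simp: sum_negf[symmetric] intro!: sum.cong)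

context sprd
begin

lemma measurable_degree [measurable]: "D i \<in> measurable M (count_space UNIV)"
  using indep_degrees by (auto simp: indep_vars_def)

lemma measurable_coin [measurable]: "B i k \<in> measurable M (count_space UNIV)"
  using indep_coins by (auto simp: indep_vars_def dest: bspec[of _ _ "(i, k)"])

text \<open>The function \<open>\<phi>\<close> treats the coins and the flipped coins at once: it is
  later taken to be the identity or \<open>Not\<close>.\<close>

lemma indep_vars_stub_data_fun:
  fixes \<phi> :: "bool \<Rightarrow> bool"
  shows "indep_vars (\<lambda>_. count_space UNIV) (stub_data D (\<lambda>i k \<omega>. \<phi> (B i k \<omega>))) UNIV"
  unfolding stub_data_def
proof (rule indep_vars_case_sum[OF indep_degrees _ indep_degrees_coins])
  have "indep_vars (\<lambda>_. count_space UNIV) (\<lambda>z. (\<lambda>b. of_bool (\<phi> b) :: nat) \<circ> (\<lambda>(i, k). B i k) z) UNIV"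
    by (rule indep_vars_compose[OF indep_coins]) simp
  then show "indep_vars (\<lambda>_. count_space UNIV) (\<lambda>(i, k) \<omega>. of_bool (\<phi> (B i k \<omega>)) :: nat) UNIV"
    by (rule indep_vars_cong[THEN iffD1, rotated -1]) auto
  show "D i \<in> measurable (vimage_algebra (space M) (\<lambda>\<omega> i. D i \<omega>) (Pi\<^sub>M UNIV (\<lambda>_. count_space UNIV))) (count_space UNIV)" for i
    using measurable_compose[OF measurable_vimage_algebra1 measurable_component_singleton,
        of "\<lambda>\<omega> i. D i \<omega>" "space M" UNIV "\<lambda>_. count_space UNIV" i]
    by (simp add: space_PiM)
  show "(case z of (i, k) \<Rightarrow> \<lambda>\<omega>. of_bool (\<phi> (B i k \<omega>)))
      \<in> measurable (vimage_algebra (space M) (\<lambda>\<omega> (i, k). B i k \<omega>) (Pi\<^sub>M UNIV (\<lambda>_. count_space UNIV)))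
          (count_space (UNIV :: nat set))" for z
  proof -
    let ?V = "vimage_algebra (space M) (\<lambda>\<omega> (i, k). B i k \<omega>) (Pi\<^sub>M UNIV (\<lambda>_. count_space UNIV))"
    have "(\<lambda>\<omega>. (\<lambda>(i, k). B i k \<omega>) z) \<in> measurable ?V (count_space UNIV)"
      using measurable_compose[OF measurable_vimage_algebra1 measurable_component_singleton,
          of "\<lambda>\<omega> (i, k). B i k \<omega>" "space M" UNIV "\<lambda>_. count_space UNIV" z]
      by (simp add: space_PiM)
    from measurable_compose[OF this, of "\<lambda>b. of_bool (\<phi> b) :: nat" "count_space UNIV"]
    show ?thesis by (simp add: case_prod_beta)
  qed
qed simp_all

lemmas indep_vars_stub_data = indep_vars_stub_data_fun[of "\<lambda>b. b"]

lemma measurable_stub_data [measurable]: "stub_data D B z \<in> measurable M (count_space UNIV)"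
  using indep_vars_stub_data by (auto simp: indep_vars_def)

lemma measurable_left_excess_stub_data [measurable]:
  "(\<lambda>\<omega>. left_excess i (\<lambda>z. stub_data D B z \<omega>)) \<in> borel_measurable M"
  by (rule measurable_compose[OF measurable_PiM_single' measurable_left_excess[of i UNIV]]) auto

lemma measurable_num_right [measurable]: "(\<lambda>\<omega>. num_right D B \<omega> i) \<in> measurable M (count_space UNIV)"
  and measurable_num_left [measurable]: "(\<lambda>\<omega>. num_left D B \<omega> i) \<in> measurable M (count_space UNIV)"
proof -
  have *: "card {k. k < d \<and> P k} = (\<Sum>k<d. of_bool (P k))" for d :: nat and P
    by (simp add: Int_def lessThan_def)
  have "(\<lambda>\<omega>. \<Sum>k<d. of_bool (\<phi> (B i k \<omega>)) :: nat) \<in> measurable M (count_space UNIV)" for d \<phi>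
    by (induction d) (simp, measurable)
  from measurable_compose_countable[OF this measurable_degree]
  have m: "(\<lambda>\<omega>. \<Sum>k<D i \<omega>. of_bool (\<phi> (B i k \<omega>)) :: nat) \<in> measurable M (count_space UNIV)" for \<phi> .
  show "(\<lambda>\<omega>. num_right D B \<omega> i) \<in> measurable M (count_space UNIV)"
    using m[of "\<lambda>b. b"] by (simp add: num_right_def *)
  show "(\<lambda>\<omega>. num_left D B \<omega> i) \<in> measurable M (count_space UNIV)"
    using m[of Not] unfolding num_left_def * .
qed

text \<open>Injectivity of \<open>h\<close> makes the blocks disjoint, and each increment is a
  function of its own block.\<close>

lemma indep_vars_left_excess:
  assumes "inj h"
  shows "indep_vars (\<lambda>_. borel) (\<lambda>k \<omega>. left_excess (h k) (\<lambda>z. stub_data D B z \<omega>)) UNIV"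
proof -
  have "disjoint_family (\<lambda>k. stub_block (h k))"
    using assms by (auto simp: disjoint_family_on_def stub_block_def dest: injD)
  from indep_vars_restrict[OF indep_vars_stub_data _ this]
  have "indep_vars (\<lambda>k. Pi\<^sub>M (stub_block (h k)) (\<lambda>_. count_space UNIV))
     (\<lambda>k \<omega>. restrict (\<lambda>z. stub_data D B z \<omega>) (stub_block (h k))) UNIV" by simp
  then have "indep_vars (\<lambda>_. borel) (\<lambda>k. left_excess (h k) \<circ>
     (\<lambda>\<omega>. restrict (\<lambda>z. stub_data D B z \<omega>) (stub_block (h k)))) UNIV"
    by (rule indep_vars_compose) (simp add: measurable_left_excess)
  then show ?thesis
    by (rule indep_vars_cong[THEN iffD1, rotated -1]) (auto intro!: left_excess_cong ext)
qed

end

section \<open>Symmetry and non-degeneracy of the increments for fair coins\<close>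

locale sprd_fair = sprd M F "1/2" D B
  for M :: "'a measure" and F D B
begin

text \<open>A fair coin keeps its law under negation, and the degrees are untouched.\<close>

lemma distr_stub_data_flip:
  "distr M (count_space UNIV) (stub_data D (\<lambda>i k \<omega>. \<not> B i k \<omega>) z)
    = distr M (count_space UNIV) (stub_data D B z)"
proof (cases z)
  case (Inr x)
  obtain i k where x: "x = (i, k)" by (cases x)
  have *: "distr M (count_space UNIV) (\<lambda>\<omega>. of_bool (\<phi> (B i k \<omega>)) :: nat)
      = measure_pmf (map_pmf (\<lambda>b. of_bool (\<phi> b)) (bernoulli_pmf (1/2)))" for \<phi>
  proof -
    have "distr M (count_space UNIV) (\<lambda>\<omega>. of_bool (\<phi> (B i k \<omega>)) :: nat)
        = distr (distr M (count_space UNIV) (B i k)) (count_space UNIV) (\<lambda>b. of_bool (\<phi> b))"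
      by (subst distr_distr) (auto simp: comp_def)
    also have "\<dots> = measure_pmf (map_pmf (\<lambda>b. of_bool (\<phi> b)) (bernoulli_pmf (1/2)))"
      by (simp add: distr_coins map_pmf_rep_eq)
    finally show ?thesis .
  qed
  have "map_pmf Not (bernoulli_pmf (1/2)) = bernoulli_pmf (1/2)"
  proof (rule pmf_eqI)
    fix b show "pmf (map_pmf Not (bernoulli_pmf (1/2))) b = pmf (bernoulli_pmf (1/2)) b"
      using pmf_map_inj'[of Not "bernoulli_pmf (1/2)" "\<not> b"] by (cases b) (auto simp: inj_def)
  qed
  then have "map_pmf (\<lambda>b. of_bool (\<not> b) :: nat) (bernoulli_pmf (1/2)) = map_pmf of_bool (bernoulli_pmf (1/2))"
    by (metis (no_types, lifting) map_pmf_comp map_pmf_cong)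
  then show ?thesis
    using *[of Not] *[of "\<lambda>b. b"] by (simp add: Inr x stub_data_def)
qed (simp add: stub_data_def)

text \<open>Negating the excess amounts to flipping all coins. The flipped family is again
  independent with the same marginals, hence has the same joint law.\<close>

lemma distr_left_excess_uminus:
  "distr M borel (\<lambda>\<omega>. left_excess i (\<lambda>z. stub_data D B z \<omega>))
    = distr M borel (\<lambda>\<omega>. - left_excess i (\<lambda>z. stub_data D B z \<omega>))"
proof -
  let ?P = "Pi\<^sub>M UNIV (\<lambda>_. count_space (UNIV :: nat set))"
  have law: "distr M borel (\<lambda>\<omega>. left_excess i (\<lambda>z. stub_data D (\<lambda>i k \<omega>. \<phi> (B i k \<omega>)) z \<omega>))
      = distr (Pi\<^sub>M UNIV (\<lambda>z. distr M (count_space UNIV) (stub_data D (\<lambda>i k \<omega>. \<phi> (B i k \<omega>)) z))) borel (left_excess i)"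
    for \<phi>
  proof -
    let ?W = "stub_data D (\<lambda>i k \<omega>. \<phi> (B i k \<omega>))"
    have W: "?W z \<in> measurable M (count_space UNIV)" for z
      using indep_vars_stub_data_fun by (auto simp: indep_vars_def)
    have "distr M ?P (\<lambda>\<omega> z. ?W z \<omega>) = Pi\<^sub>M UNIV (\<lambda>z. distr M (count_space UNIV) (?W z))"
      using indep_vars_stub_data_fun[of \<phi>] W by (simp add: indep_vars_iff_distr_eq_PiM restrict_UNIV)
    moreover have "distr M borel (\<lambda>\<omega>. left_excess i (\<lambda>z. ?W z \<omega>))
        = distr (distr M ?P (\<lambda>\<omega> z. ?W z \<omega>)) borel (left_excess i)"
      using W by (subst distr_distr) (auto simp: comp_def intro!: measurable_left_excess measurable_PiM_single')
    ultimately show ?thesis by simp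
  qed
  show ?thesis
    using law[of Not] law[of "\<lambda>b. b"] by (simp add: left_excess_flip distr_stub_data_flip)
qed

text \<open>If the degree is \<open>d\<close> and the first \<open>d\<close> coins all give
  left-arrows, the excess equals \<open>d\<close>. By independence this happens with the probability
  on the left, which is the same for all vertices.\<close>

lemma prob_left_excess_ge_1:
  assumes d: "d > 0"
  shows "pmf F d * (1/2) ^ d \<le> prob {\<omega> \<in> space M. left_excess i (\<lambda>z. stub_data D B z \<omega>) \<ge> 1}"
proof -
  let ?J = "insert (Inl i) ((\<lambda>k. Inr (i, k)) ` {..<d})"
  let ?A = "\<lambda>z. case z of Inl _ \<Rightarrow> {d} | Inr _ \<Rightarrow> {0}"
  let ?E = "\<Inter>z\<in>?J. stub_data D B z -` ?A z \<inter> space M"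
  have degree: "prob (D i -` {d} \<inter> space M) = pmf F d"
    using arg_cong[OF distr_degrees[of i], of "\<lambda>N. measure N {d}"]
    by (simp add: measure_distr measure_pmf_single)
  have coin: "prob (B i k -` {False} \<inter> space M) = 1/2" for k
    using arg_cong[OF distr_coins[of i k], of "\<lambda>N. measure N {False}"]
    by (simp add: measure_distr measure_pmf_single)
  have "prob ?E = (\<Prod>z\<in>?J. prob (stub_data D B z -` ?A z \<inter> space M))"
    by (intro indep_varsD[OF indep_vars_stub_data]) auto
  also have "\<dots> = prob (D i -` {d} \<inter> space M) * (\<Prod>k<d. prob (B i k -` {False} \<inter> space M))"
    by (subst prod.insert) (auto simp: prod.reindex inj_on_def stub_data_def vimage_def)
  also have "\<dots> = pmf F d * (1/2) ^ d"
    unfolding degree coin by simp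
  finally have "prob ?E = pmf F d * (1/2) ^ d" .
  moreover have "prob ?E \<le> prob {\<omega> \<in> space M. left_excess i (\<lambda>z. stub_data D B z \<omega>) \<ge> 1}"
  proof (rule finite_measure_mono)
    show "?E \<subseteq> {\<omega> \<in> space M. left_excess i (\<lambda>z. stub_data D B z \<omega>) \<ge> 1}"
      using d by (auto simp: left_excess_def stub_data_def)
  qed measurable
  ultimately show ?thesis by simp
qed

text \<open>Both signs are needed: the walk to the right of 0 has increments \<open>L - R\<close>,
  the walk to the left \<open>R - L\<close>.\<close>

lemma left_excess_walk_unbounded:
  fixes h :: "nat \<Rightarrow> int"
  assumes h: "inj h" and F: "F \<noteq> return_pmf 0"
  shows "AE \<omega> in M. \<forall>C::nat. \<exists>n. real C < (\<Sum>k<n. left_excess (h k) (\<lambda>z. stub_data D B z \<omega>))"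
    and "AE \<omega> in M. \<forall>C::nat. \<exists>n. real C < (\<Sum>k<n. - left_excess (h k) (\<lambda>z. stub_data D B z \<omega>))"
proof -
  let ?X = "\<lambda>k \<omega>. left_excess (h k) (\<lambda>z. stub_data D B z \<omega>)"
  obtain d where d: "d > 0" "pmf F d > 0"
  proof -
    have "\<not> set_pmf F \<subseteq> {0}" using F set_pmf_subset_singleton by metis
    then obtain d where "d \<in> set_pmf F" "d \<noteq> 0" by blast
    then show ?thesis using that[of d] by (simp add: pmf_positive)
  qed
  \<comment> \<open>A lower bound uniform in \<open>k\<close>; it is positive because
    \<open>d\<close> is a positive degree charged by \<open>F\<close>.\<close>
  define q where "q = pmf F d * (1/2) ^ d"
  have q: "q > 0" "prob {\<omega> \<in> space M. ?X k \<omega> \<ge> 1} \<ge> q" for k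
    using d prob_left_excess_ge_1[OF d(1)] by (auto simp: q_def)
  have "prob {\<omega> \<in> space M. - ?X k \<omega> \<ge> 1} = prob {\<omega> \<in> space M. ?X k \<omega> \<ge> 1}" for k
    using arg_cong[OF distr_left_excess_uminus, of "\<lambda>N. measure N {1..}" "h k"]
    by (simp add: measure_distr vimage_def Int_def conj_commute)
  then have q': "prob {\<omega> \<in> space M. - ?X k \<omega> \<ge> 1} \<ge> q" for k using q by simp
  have ind: "indep_vars (\<lambda>_. borel) ?X UNIV" by (rule indep_vars_left_excess[OF h])
  have "indep_vars (\<lambda>_. borel) (\<lambda>k. uminus \<circ> ?X k) UNIV"
    by (rule indep_vars_compose[OF ind]) simp
  then have ind': "indep_vars (\<lambda>_. borel) (\<lambda>k \<omega>. - ?X k \<omega>) UNIV" by (simp add: comp_def)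
  show "AE \<omega> in M. \<forall>C::nat. \<exists>n. real C < (\<Sum>k<n. ?X k \<omega>)"
    by (intro symmetric_walk_unbounded[OF ind _ q(1)] distr_left_excess_uminus q(2))
  show "AE \<omega> in M. \<forall>C::nat. \<exists>n. real C < (\<Sum>k<n. - ?X k \<omega>)"
    using distr_left_excess_uminus
    by (intro symmetric_walk_unbounded[OF ind' _ q(1)] q') simp
qed

lemma AE_sprd_N_less_infinity: "AE \<omega> in M. sprd_N D B \<omega> < \<infinity>"
proof (cases "F = return_pmf 0")
  case True
  have "AE d in distr M (count_space UNIV) (D 0). d = 0"
    unfolding distr_degrees True by (simp add: AE_measure_pmf_iff)
  then have "AE \<omega> in M. D 0 \<omega> = 0" by (simp add: AE_distr_iff)
  then show ?thesis
  proof (rule AE_mp, intro AE_I2 impI)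
    fix \<omega> assume "D 0 \<omega> = 0"
    then show "sprd_N D B \<omega> < \<infinity>"
      unfolding sprd_N_def max_length_less_infinity_iff by (simp add: num_right_def num_left_def)
  qed
next
  case False
  \<comment> \<open>These enumerate the vertices to the right and to the left of 0, starting next to
    it.\<close>
  have "inj (\<lambda>k::nat. int k + 1)" "inj (\<lambda>k::nat. - int k - 1)" by (auto simp: inj_def)
  note this(1)[THEN left_excess_walk_unbounded(1)[OF _ False]]
    this(2)[THEN left_excess_walk_unbounded(2)[OF _ False]]
  then show ?thesis
    unfolding sprd_N_def left_excess_stub_data minus_diff_eq
    by eventually_elim (intro max_length_less_infinity; erule spec)
qed

lemma prob_sprd_N_less_infinity: "prob {\<omega> \<in> space M. sprd_N D B \<omega> < \<infinity>} = 1"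
proof -
  \<comment> \<open>Since \<open>measure\<close> is 0 outside the sigma-algebra, the almost sure
    statement alone would not give probability 1.\<close>
  have "Measurable.pred M (\<lambda>\<omega>. sprd_N D B \<omega> < \<infinity>)"
    unfolding sprd_N_def by (intro pred_max_length_less_infinity) measurable
  then show ?thesis using AE_sprd_N_less_infinity by (subst prob_Collect_eq_1) (auto simp: pred_def)
qed

end

theorem theorem2p1:
  fixes M :: "'a measure" and F :: "nat pmf"
    and D :: "int \<Rightarrow> 'a \<Rightarrow> nat" and B :: "int \<Rightarrow> nat \<Rightarrow> 'a \<Rightarrow> bool"
  assumes "sprd M F (1/2) D B"
  shows "measure M {\<omega> \<in> space M. sprd_N D B \<omega> < \<infinity>} = 1"
  using sprd_fair.prob_sprd_N_less_infinity[of M F D B] assms by (simp add: sprd_fair_def)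

end
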